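(* Let $G$ be a connected graph of order $n\ge 2$ and let $\mathcal{H}=\{H_1,\dots,H_n\}$ be a family of $n$ non-trivial graphs such that every $H_i\in\mathcal{H}$ is $k_i$-metric dimensional and $D(H_i)\le 2$. If $k'=\min_{i\in\{1,\dots,n\}}\{k_i\}$, then for every $k\in\{1,\dots,k'\}$, $$\dim_k(G\odot\mathcal{H})=\sum_{i=1}^{n}\dim_k(H_i).$$
   Context: All graphs are finite, simple and undirected; a graph is non-trivial if it has at least two vertices. $D(H)$ is the diameter of $H$ (so $D(H)\le 2$ entails that $H$ is connected). For a connected graph $\Gamma$, $d_\Gamma(x,y)$ is the length of a shortest path between $x$ and $y$. For a positive integer $k$, a set $S\subseteq V(\Gamma)$ is a $k$-metric generator for $\Gamma$ if for any two different vertices $u,v$ of $\Gamma$ there are at least $k$ vertices $w\in S$ with $d_\Gamma(u,w)\neq d_\Gamma(v,w)$. A $k$-metric basis is a $k$-metric generator of minimum cardinality, and its cardinality is the $k$-metric dimension $\dim_k(\Gamma)$. A connected graph is $k'$-metric dimensional if $k'$ is the largest integer for which a $k'$-metric basis exists. Corona product: if $G$ has vertices $v_1,\dots,v_n$ and $\mathcal{H}=\{H_1,\dots,H_n\}$ is a family of $n$ graphs (repetitions up to isomorphism allowed), $G\odot\mathcal{H}$ is obtained from the disjoint union of $G$ and $H_1,\dots,H_n$ by joining, for each $i$, the vertex $v_i$ by an edge to every vertex of $H_i$. *)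

theory Defs
  imports "Graph_Theory.Graph_Theory"
begin

text \<open>
  A finite simple undirected graph is a \<^locale>\<open>pair_graph\<close>: finitely many vertices, and a symmetric
  irreflexive set of arcs, each undirected edge being a pair of opposite arcs.
\<close>

text \<open>Shortest path distance; it is infinite if no walk exists.\<close>

definition gdist :: "'a pair_pre_digraph \<Rightarrow> 'a \<Rightarrow> 'a \<Rightarrow> ereal" where
  "gdist G u v = wf_digraph.\<mu> (with_proj G) (\<lambda>_. 1) u v"

text \<open>The diameter is infinite for a disconnected graph.\<close>

definition diameter :: "'a pair_pre_digraph \<Rightarrow> ereal" where
  "diameter G = (SUP u\<in>pverts G. SUP v\<in>pverts G. gdist G u v)"

definition k_metric_generator :: "nat \<Rightarrow> 'a pair_pre_digraph \<Rightarrow> 'a set \<Rightarrow> bool" where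
  "k_metric_generator k G S \<longleftrightarrow> S \<subseteq> pverts G \<and>
     (\<forall>u\<in>pverts G. \<forall>v\<in>pverts G. u \<noteq> v \<longrightarrow> k \<le> card {w \<in> S. gdist G u w \<noteq> gdist G v w})"

definition k_metric_basis :: "nat \<Rightarrow> 'a pair_pre_digraph \<Rightarrow> 'a set \<Rightarrow> bool" where
  "k_metric_basis k G S \<longleftrightarrow> k_metric_generator k G S \<and>
     (\<forall>T. k_metric_generator k G T \<longrightarrow> card S \<le> card T)"

text \<open>Meaningful only if a \<open>k\<close>-metric basis exists, see \<open>k_metric_dim_eq\<close> below.\<close>

definition k_metric_dim :: "nat \<Rightarrow> 'a pair_pre_digraph \<Rightarrow> nat" where
  "k_metric_dim k G = (THE m. \<exists>S. k_metric_basis k G S \<and> card S = m)"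

definition metric_dimensional :: "nat \<Rightarrow> 'a pair_pre_digraph \<Rightarrow> bool" where
  "metric_dimensional k G \<longleftrightarrow> Digraph_Component.connected (with_proj G) \<and> 0 < k \<and>
     (\<exists>S. k_metric_basis k G S) \<and> (\<forall>m. (\<exists>S. k_metric_basis m G S) \<longrightarrow> m \<le> k)"

text \<open>
  The family \<open>H\<close> is indexed by the vertices of \<open>G\<close>. The disjoint union is realised as a tagged sum:
  \<open>Inl v\<close> is the vertex \<open>v\<close> of \<open>G\<close>, and \<open>Inr (v, x)\<close> is the vertex \<open>x\<close> of the copy of \<open>H v\<close>.
\<close>

definition corona ::
  "'a pair_pre_digraph \<Rightarrow> ('a \<Rightarrow> 'b pair_pre_digraph) \<Rightarrow> ('a + 'a \<times> 'b) pair_pre_digraph" where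
  "corona G H = \<lparr>
     pverts = {Inl v | v. v \<in> pverts G} \<union> {Inr (v, x) | v x. v \<in> pverts G \<and> x \<in> pverts (H v)},
     parcs = {(Inl u, Inl v) | u v. (u, v) \<in> parcs G}
       \<union> {(Inr (v, x), Inr (v, y)) | v x y. v \<in> pverts G \<and> (x, y) \<in> parcs (H v)}
       \<union> {(Inl v, Inr (v, x)) | v x. v \<in> pverts G \<and> x \<in> pverts (H v)}
       \<union> {(Inr (v, x), Inl v) | v x. v \<in> pverts G \<and> x \<in> pverts (H v)} \<rparr>"

lemma k_metric_basis_exists:
  assumes "k_metric_generator k G S"
  shows "\<exists>B. k_metric_basis k G B"
  using ex_has_least_nat[of "k_metric_generator k G" S card] assms
  unfolding k_metric_basis_def by blast

lemma k_metric_dim_eq: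
  assumes "k_metric_basis k G S"
  shows "k_metric_dim k G = card S"
  unfolding k_metric_dim_def
proof (rule the_equality)
  show "\<exists>B. k_metric_basis k G B \<and> card B = card S" using assms by blast
  show "m = card S" if "\<exists>B. k_metric_basis k G B \<and> card B = m" for m
    using that assms unfolding k_metric_basis_def by (meson le_antisym)
qed

lemma pair_graph_corona:
  assumes G: "pair_graph G" and H: "\<And>v. v \<in> pverts G \<Longrightarrow> pair_graph (H v)"
  shows "pair_graph (corona G H)"
proof -
  interpret G: pair_graph G by fact
  have Gloop: "(x, x) \<notin> parcs G" for x using G.pair_no_loops by force
  have verts: "(x, y) \<in> parcs (H v) \<Longrightarrow> x \<in> pverts (H v) \<and> y \<in> pverts (H v)"
    and noloop: "(x, x) \<notin> parcs (H v)"
    and sym: "(x, y) \<in> parcs (H v) \<Longrightarrow> (y, x) \<in> parcs (H v)"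
    and fin: "finite (pverts (H v))"
    if "v \<in> pverts G" for v x y
  proof -
    interpret Hv: pair_graph "H v" by (rule H[OF that])
    show "(x, y) \<in> parcs (H v) \<Longrightarrow> x \<in> pverts (H v) \<and> y \<in> pverts (H v)"
      using Hv.in_arcsD1 Hv.in_arcsD2 by blast
    show "(x, x) \<notin> parcs (H v)" using Hv.pair_no_loops by force
    show "(x, y) \<in> parcs (H v) \<Longrightarrow> (y, x) \<in> parcs (H v)"
      using Hv.arcs_symmetric by blast
    show "finite (pverts (H v))" by (rule Hv.pair_finite_verts)
  qed
  have V: "pverts (corona G H) = Inl ` pverts G \<union> Inr ` (SIGMA v:pverts G. pverts (H v))"
    by (auto simp: corona_def)
  have finV: "finite (pverts (corona G H))"
    unfolding V using fin by auto
  have arcV: "parcs (corona G H) \<subseteq> pverts (corona G H) \<times> pverts (corona G H)"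
    by (auto simp: corona_def dest: verts G.in_arcsD1 G.in_arcsD2)
  show ?thesis
  proof
    show "finite (pverts (corona G H))" by fact
    show "finite (parcs (corona G H))"
      using arcV finV by (meson finite_SigmaI finite_subset)
    show "fst e \<in> pverts (corona G H)" "snd e \<in> pverts (corona G H)"
      if "e \<in> parcs (corona G H)" for e
      using that arcV by auto
    show "fst e \<noteq> snd e" if "e \<in> parcs (corona G H)" for e
      using that by (auto simp: corona_def noloop Gloop)
    show "symmetric (with_proj (corona G H))"
      unfolding symmetric_def with_proj_simps
      by (rule symI) (auto simp: corona_def dest: sym G.arcs_symmetric)
  qed
qed

end

theory Submission
  imports Defs
begin

text \<open>
  The theorem rests on a description of the distances in the corona \<open>C\<close>. Inside the copy of \<open>H v\<close>
  they are the distances of \<open>H v\<close>: any two vertices of the copy have the common neighbour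
  \<open>v\<close>, so their distance in \<open>C\<close> is the minimum of \<open>2\<close> and their distance in \<open>H v\<close>, and the diameter
  of \<open>H v\<close> is at most \<open>2\<close> (\<open>gdist_same_copy\<close>). Seen from a vertex outside the copy, \<open>v\<close> is a
  cut vertex, so every vertex of the copy is exactly one step further away than \<open>v\<close>
  (\<open>gdist_leave_copy\<close>).

  Two vertices of one copy can therefore be distinguished only by vertices of that copy. Hence every
  \<open>k\<close>-metric generator of \<open>C\<close> meets each copy in a \<open>k\<close>-metric generator of \<open>H v\<close>, and has at least
  \<open>\<Sum>v. dim\<^sub>k (H v)\<close> elements. Conversely, place a \<open>k\<close>-metric generator \<open>S v\<close> of \<open>H v\<close> in every copy.
  Two vertices of one copy are distinguished by \<open>k\<close> vertices within it. Two vertices that do not lie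
  in one copy are distinguished by all the vertices of some copy (\<open>separating_copy\<close>), and \<open>S v\<close> has at
  least \<open>k\<close> elements because \<open>H v\<close> has two distinct vertices.
\<close>

section \<open>Distances in directed and undirected graphs\<close>

context pair_wf_digraph
begin

lemma gdist_eq_INF_length: "gdist G u v = (INF p\<in>{p. awalk u p v}. ereal (real (length p)))"
proof -
  have "awalk_cost (\<lambda>_. 1) p = real (length p)" for p :: "('a \<times> 'a) list"
    by (induct p) auto
  then show ?thesis
    by (simp add: gdist_def \<mu>_def)
qed

lemma gdist_le_length: "awalk u p v \<Longrightarrow> gdist G u v \<le> real (length p)"
  unfolding gdist_eq_INF_length by (rule INF_lower) simp

lemma gdist_nonneg: "0 \<le> gdist G u v"
  unfolding gdist_eq_INF_length by (rule INF_greatest) simp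

lemma gdist_self: "u \<in> pverts G \<Longrightarrow> gdist G u u = 0"
  using gdist_le_length[of u "[]" u] gdist_nonneg[of u u] by (simp add: awalk_Nil_iff zero_ereal_def)

text \<open>
  The lower bounds on distances come from this fact: a function that drops by at most one along
  every arc cannot drop by more than the length of a walk.
\<close>

lemma potential_le_gdist:
  fixes f :: "'a \<Rightarrow> ereal"
  assumes step: "\<And>a b. (a, b) \<in> parcs G \<Longrightarrow> f a \<le> 1 + f b"
    and nonneg: "0 \<le> f v"
  shows "f u \<le> gdist G u v + f v"
proof (cases "f v = \<infinity>")
  case False
  have walk: "f u \<le> real (length p) + f v" if "awalk u p v" for p
    using that
  proof (induct p arbitrary: u)
    case Nil
    then show ?case by (simp add: awalk_Nil_iff zero_ereal_def[symmetric])
  next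
    case (Cons e p)
    then have "f u \<le> 1 + f (snd e)" "f (snd e) \<le> real (length p) + f v"
      using step[of "fst e" "snd e"] by (auto simp: awalk_Cons_iff)
    then have "f u \<le> 1 + (real (length p) + f v)"
      by (meson add_left_mono order_trans)
    also have "\<dots> = real (length (e # p)) + f v"
      by (cases "f v") (auto simp: one_ereal_def)
    finally show ?case .
  qed
  have "f u - f v \<le> gdist G u v"
    unfolding gdist_eq_INF_length
  proof (rule INF_greatest)
    fix p assume "p \<in> {p. awalk u p v}"
    then show "f u - f v \<le> real (length p)"
      using walk[of p] False nonneg by (cases "f u"; cases "f v") auto
  qed
  then show ?thesis
    using False nonneg by (cases "f u"; cases "f v"; cases "gdist G u v") auto
next
  case True
  then show ?thesis
    using gdist_nonneg[of u v] by auto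
qed

lemma gdist_arc_step:
  assumes "(a, b) \<in> parcs G"
  shows "gdist G a v \<le> 1 + gdist G b v"
proof -
  have "gdist G a v - 1 \<le> gdist G b v"
    unfolding gdist_eq_INF_length[of b]
  proof (rule INF_greatest)
    fix p assume "p \<in> {p. awalk b p v}"
    with assms have "awalk a ((a, b) # p) v"
      by (simp add: awalk_Cons_iff)
    from gdist_le_length[OF this] show "gdist G a v - 1 \<le> real (length p)"
      by (cases "gdist G a v") (auto simp: one_ereal_def)
  qed
  then show ?thesis
    by (cases "gdist G a v"; cases "gdist G b v") (auto simp: one_ereal_def)
qed

lemma gdist_le_1: "(u, v) \<in> parcs G \<Longrightarrow> gdist G u v \<le> 1"
  using gdist_arc_step[of u v v] by (simp add: gdist_self in_arcsD2)

lemma gdist_le_2: "(u, w) \<in> parcs G \<Longrightarrow> (w, v) \<in> parcs G \<Longrightarrow> gdist G u v \<le> 2"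
  using gdist_arc_step[of u w v] add_left_mono[OF gdist_le_1[of w v], of 1] by auto

lemma gdist_ge_truncated:
  "(if u = v then 0 else if (u, v) \<in> parcs G then 1 else (2::ereal)) \<le> gdist G u v"
proof -
  let ?f = "\<lambda>a. if a = v then 0 else if (a, v) \<in> parcs G then 1 else (2::ereal)"
  have "?f u \<le> gdist G u v + ?f v"
    by (rule potential_le_gdist) (auto simp: one_ereal_def numeral_eq_ereal)
  then show ?thesis by simp
qed

text \<open>
  Distances up to \<open>2\<close> depend only on equality and adjacency of the two vertices. This makes it
  possible to compare distances in two graphs without transporting walks.
\<close>

lemma gdist_eq_truncated:
  assumes "u \<in> pverts G" "gdist G u v \<le> 2"
  shows "gdist G u v = (if u = v then 0 else if (u, v) \<in> parcs G then 1 else (2::ereal))"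
  using assms gdist_ge_truncated[of u v] gdist_le_1[of u v] gdist_self[of u]
  by (auto split: if_splits intro: antisym)

lemma gdist_le_diameter: "u \<in> pverts G \<Longrightarrow> v \<in> pverts G \<Longrightarrow> gdist G u v \<le> diameter G"
  unfolding diameter_def by (meson SUP_upper2 order_refl)

end

lemma (in pair_sym_digraph) gdist_finite_if_connected:
  assumes "Digraph_Component.connected (with_proj G)" "u \<in> pverts G" "v \<in> pverts G"
  shows "gdist G u v < \<infinity>"
  using symmetric_connected_imp_strongly_connected[OF pair_sym_arcs] assms \<mu>_reach_conv
  by (auto simp: gdist_def strongly_connected_def)

section \<open>Metric generators\<close>

lemma k_metric_generator_mono:
  "k_metric_generator m G S \<Longrightarrow> k \<le> m \<Longrightarrow> k_metric_generator k G S"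
  unfolding k_metric_generator_def by (meson order_trans)

lemma k_metric_generator_le_card:
  assumes "k_metric_generator k G S" "2 \<le> card (pverts G)"
  shows "k \<le> card S"
proof -
  have fin: "finite (pverts G)"
    using assms(2) card.infinite by fastforce
  have "\<not> card (pverts G) \<le> Suc 0"
    using assms(2) by simp
  then obtain u v where "u \<in> pverts G" "v \<in> pverts G" "u \<noteq> v"
    using card_le_Suc0_iff_eq[OF fin] by auto
  then have "k \<le> card {w \<in> S. gdist G u w \<noteq> gdist G v w}"
    using assms(1) by (auto simp: k_metric_generator_def)
  also have "\<dots> \<le> card S"
    using assms(1) fin by (intro card_mono) (auto simp: k_metric_generator_def intro: finite_subset)
  finally show ?thesis .
qed

section \<open>Distances in the corona\<close>

lemma corona_simps [simp]:
  "Inl v \<in> pverts (corona G H) \<longleftrightarrow> v \<in> pverts G"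
  "Inr (v, x) \<in> pverts (corona G H) \<longleftrightarrow> v \<in> pverts G \<and> x \<in> pverts (H v)"
  "(Inl v, Inl w) \<in> parcs (corona G H) \<longleftrightarrow> (v, w) \<in> parcs G"
  "(Inl v, Inr (w, y)) \<in> parcs (corona G H) \<longleftrightarrow> v = w \<and> v \<in> pverts G \<and> y \<in> pverts (H v)"
  "(Inr (v, x), Inl w) \<in> parcs (corona G H) \<longleftrightarrow> v = w \<and> v \<in> pverts G \<and> x \<in> pverts (H v)"
  "(Inr (v, x), Inr (w, y)) \<in> parcs (corona G H) \<longleftrightarrow> v = w \<and> v \<in> pverts G \<and> (x, y) \<in> parcs (H v)"
  by (auto simp: corona_def)

locale corona_graph =
  G: pair_graph G for G :: "'a pair_pre_digraph" +
  fixes H :: "'a \<Rightarrow> 'b pair_pre_digraph"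
  assumes pair_graph_H: "\<And>v. v \<in> pverts G \<Longrightarrow> pair_graph (H v)"
begin

sublocale C: pair_graph "corona G H"
  using pair_graph_corona[OF G.pair_graph pair_graph_H] .

text \<open>
  The vertex \<open>v\<close> separates the copy of \<open>H v\<close> from the rest. The lower bound comes from the potential
  that is the distance to \<open>z\<close> outside the copy and is constant, one more than at \<open>v\<close>, on the copy.
\<close>

lemma gdist_leave_copy:
  assumes v: "v \<in> pverts G" and x: "x \<in> pverts (H v)" and z: "z \<notin> range (\<lambda>y. Inr (v, y))"
    and zV: "z \<in> pverts (corona G H)"
  shows "gdist (corona G H) (Inr (v, x)) z = 1 + gdist (corona G H) (Inl v) z"
proof (rule antisym)
  show "gdist (corona G H) (Inr (v, x)) z \<le> 1 + gdist (corona G H) (Inl v) z"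
    using v x by (intro C.gdist_arc_step) simp
  define f where "f a = gdist (corona G H) (if a \<in> range (\<lambda>y. Inr (v, y)) then Inl v else a) z
      + (if a \<in> range (\<lambda>y. Inr (v, y)) then 1 else 0)" for a
  have "f a \<le> 1 + f b" if ab: "(a, b) \<in> parcs (corona G H)" for a b
  proof (cases "b \<in> range (\<lambda>y. Inr (v, y))")
    case b: True
    show ?thesis
    proof (cases "a \<in> range (\<lambda>y. Inr (v, y))")
      case True
      with b have "f a = f b" by (simp add: f_def)
      then show ?thesis by (cases "f b") (auto simp: one_ereal_def)
    next
      case False
      with b ab have "a = Inl v" by (cases a) auto
      with b have "f b = 1 + f a" by (auto simp: f_def add.commute)
      then show ?thesis by (cases "f a") (auto simp: one_ereal_def)
    qed
  next
    case b: False
    show ?thesis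
    proof (cases "a \<in> range (\<lambda>y. Inr (v, y))")
      case True
      with b ab have "b = Inl v" by (cases b) auto
      with True show ?thesis by (auto simp: f_def add.commute)
    next
      case False
      with b C.gdist_arc_step[OF ab] show ?thesis by (simp add: f_def)
    qed
  qed
  moreover have "f z = 0"
    using z zV by (simp add: f_def C.gdist_self)
  ultimately have "f (Inr (v, x)) \<le> gdist (corona G H) (Inr (v, x)) z"
    using C.potential_le_gdist[of f z "Inr (v, x)"] by simp
  then show "1 + gdist (corona G H) (Inl v) z \<le> gdist (corona G H) (Inr (v, x)) z"
    by (auto simp: f_def add.commute)
qed

lemma gdist_copy_le_2:
  "v \<in> pverts G \<Longrightarrow> x \<in> pverts (H v) \<Longrightarrow> y \<in> pverts (H v) \<Longrightarrow>
    gdist (corona G H) (Inr (v, x)) (Inr (v, y)) \<le> 2"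
  by (rule C.gdist_le_2[where w = "Inl v"]) simp_all

lemma gdist_same_copy:
  assumes v: "v \<in> pverts G" and diam: "diameter (H v) \<le> 2"
    and x: "x \<in> pverts (H v)" and y: "y \<in> pverts (H v)"
  shows "gdist (corona G H) (Inr (v, x)) (Inr (v, y)) = gdist (H v) x y"
proof -
  interpret Hv: pair_graph "H v" using pair_graph_H[OF v] .
  have "gdist (H v) x y \<le> 2"
    using Hv.gdist_le_diameter[OF x y] diam by (rule order_trans)
  from Hv.gdist_eq_truncated[OF x this] show ?thesis
    using C.gdist_eq_truncated[OF _ gdist_copy_le_2[OF v x y]] v x by simp
qed

lemma gdist_base_to_other_copy:
  assumes "v \<noteq> w"
  shows "2 \<le> gdist (corona G H) (Inl v) (Inr (w, y))"
  using C.gdist_ge_truncated[of "Inl v" "Inr (w, y)"] assms by simp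

lemma gdist_base_to_own_copy:
  assumes "v \<in> pverts G" "y \<in> pverts (H v)"
  shows "gdist (corona G H) (Inl v) (Inr (v, y)) \<le> 1"
  using assms by (intro C.gdist_le_1) simp

lemma gdist_between_copies:
  assumes "v \<in> pverts G" "x \<in> pverts (H v)" "w \<in> pverts G" "y \<in> pverts (H w)" "v \<noteq> w"
  shows "3 \<le> gdist (corona G H) (Inr (v, x)) (Inr (w, y))"
proof -
  have "gdist (corona G H) (Inr (v, x)) (Inr (w, y))
      = 1 + gdist (corona G H) (Inl v) (Inr (w, y))"
    using assms by (intro gdist_leave_copy) auto
  moreover have "1 + 2 \<le> 1 + gdist (corona G H) (Inl v) (Inr (w, y))"
    using gdist_base_to_other_copy[OF assms(5)] by (rule add_left_mono)
  ultimately show ?thesis by simp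
qed

lemma gdist_base_finite:
  assumes "Digraph_Component.connected (with_proj G)"
    and v: "v \<in> pverts G" and w: "w \<in> pverts G" and y: "y \<in> pverts (H w)"
  shows "gdist (corona G H) (Inl v) (Inr (w, y)) < \<infinity>"
proof -
  let ?f = "\<lambda>u. gdist (corona G H) (Inl u) (Inr (w, y))"
  have "?f v \<le> gdist G v w + ?f w"
    by (rule G.potential_le_gdist) (auto intro: C.gdist_arc_step C.gdist_nonneg)
  moreover have "gdist G v w < \<infinity>"
    using assms by (intro G.gdist_finite_if_connected)
  ultimately show ?thesis
    using gdist_base_to_own_copy[OF w y] by (cases "gdist G v w"; cases "?f w") auto
qed

text \<open>
  For a base vertex \<open>v\<close> and a vertex of its own copy, any other copy works, because it is one step
  closer to \<open>v\<close>; here another base vertex has to exist, and connectedness of \<open>G\<close> makes the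
  distances finite, so that one step makes a difference. In the remaining cases of this lemma and
  the next one, the copy of one of the base vertices involved works.
\<close>

lemma separating_copy_base:
  assumes conn: "Digraph_Component.connected (with_proj G)" and two: "2 \<le> card (pverts G)"
    and v: "v \<in> pverts G" and w: "w \<in> pverts G" and x: "x \<in> pverts (H w)"
  shows "\<exists>u\<in>pverts G. \<forall>s\<in>pverts (H u). gdist (corona G H) (Inl v) (Inr (u, s))
           \<noteq> gdist (corona G H) (Inr (w, x)) (Inr (u, s))"
proof (cases "v = w")
  case True
  have "pverts G \<noteq> {v}"
    using two by auto
  then obtain u where u: "u \<in> pverts G" "u \<noteq> v"
    using v by auto
  have "gdist (corona G H) (Inl v) (Inr (u, s)) \<noteq> gdist (corona G H) (Inr (w, x)) (Inr (u, s))"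
    if s: "s \<in> pverts (H u)" for s
  proof -
    have "gdist (corona G H) (Inr (v, x)) (Inr (u, s)) = 1 + gdist (corona G H) (Inl v) (Inr (u, s))"
      using u s v x True by (intro gdist_leave_copy) auto
    then show ?thesis
      using gdist_base_finite[OF conn v u(1) s] C.gdist_nonneg[of "Inl v" "Inr (u, s)"] True
      by (cases "gdist (corona G H) (Inl v) (Inr (u, s))") (auto simp: one_ereal_def)
  qed
  with u show ?thesis by blast
next
  case False
  have "gdist (corona G H) (Inl v) (Inr (v, s)) \<noteq> gdist (corona G H) (Inr (w, x)) (Inr (v, s))"
    if s: "s \<in> pverts (H v)" for s
  proof -
    have "gdist (corona G H) (Inl v) (Inr (v, s)) < 3"
      using gdist_base_to_own_copy[OF v s] by (rule le_less_trans) simp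
    then show ?thesis
      using gdist_between_copies[OF w x v s] False by auto
  qed
  with v show ?thesis by blast
qed

lemma separating_copy:
  assumes conn: "Digraph_Component.connected (with_proj G)" and two: "2 \<le> card (pverts G)"
    and p: "p \<in> pverts (corona G H)" and q: "q \<in> pverts (corona G H)" and "p \<noteq> q"
    and copies: "\<And>v x y. p = Inr (v, x) \<Longrightarrow> q \<noteq> Inr (v, y)"
  shows "\<exists>u\<in>pverts G. \<forall>s\<in>pverts (H u).
           gdist (corona G H) p (Inr (u, s)) \<noteq> gdist (corona G H) q (Inr (u, s))"
proof (cases p)
  case p': (Inl v)
  show ?thesis
  proof (cases q)
    case q': (Inl w)
    have "gdist (corona G H) p (Inr (v, s)) \<noteq> gdist (corona G H) q (Inr (v, s))"
      if s: "s \<in> pverts (H v)" for s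
    proof -
      have "gdist (corona G H) p (Inr (v, s)) < 2"
        using gdist_base_to_own_copy[OF _ s] p p' by (auto intro: le_less_trans)
      then show ?thesis
        using gdist_base_to_other_copy[of w v s] p' q' \<open>p \<noteq> q\<close> by auto
    qed
    with p p' show ?thesis by auto
  next
    case (Inr wx)
    then show ?thesis
      using separating_copy_base[OF conn two, of v "fst wx" "snd wx"] p q p' by (cases wx) auto
  qed
next
  case p': (Inr vx)
  then obtain v x where vx: "p = Inr (v, x)" by (cases vx) auto
  show ?thesis
  proof (cases q)
    case (Inl w)
    then show ?thesis
      using separating_copy_base[OF conn two, of w v x] p q vx by fastforce
  next
    case (Inr wy)
    then obtain w y where wy: "q = Inr (w, y)" by (cases wy) auto
    with vx copies have "v \<noteq> w" by auto
    have "gdist (corona G H) p (Inr (v, s)) \<noteq> gdist (corona G H) q (Inr (v, s))"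
      if s: "s \<in> pverts (H v)" for s
    proof -
      have "gdist (corona G H) p (Inr (v, s)) < 3"
        using gdist_copy_le_2[of v x s] s p vx by (auto intro: le_less_trans)
      then show ?thesis
        using gdist_between_copies[of w y v s] p q vx wy s \<open>v \<noteq> w\<close> by auto
    qed
    with p vx show ?thesis by auto
  qed
qed

section \<open>Metric generators of the corona\<close>

lemma k_metric_generator_fibre:
  assumes T: "k_metric_generator k (corona G H) T" and v: "v \<in> pverts G"
    and diam: "diameter (H v) \<le> 2"
  shows "k_metric_generator k (H v) {x. Inr (v, x) \<in> T}"
  unfolding k_metric_generator_def
proof (intro conjI ballI impI)
  interpret Hv: pair_graph "H v" using pair_graph_H[OF v] .
  let ?F = "{x. Inr (v, x) \<in> T}"
  have TV: "T \<subseteq> pverts (corona G H)"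
    using T by (simp add: k_metric_generator_def)
  then show sub: "?F \<subseteq> pverts (H v)"
    by auto
  fix x y assume x: "x \<in> pverts (H v)" and y: "y \<in> pverts (H v)" and "x \<noteq> y"
  let ?D = "{w \<in> T. gdist (corona G H) (Inr (v, x)) w \<noteq> gdist (corona G H) (Inr (v, y)) w}"
  let ?E = "{w \<in> ?F. gdist (H v) x w \<noteq> gdist (H v) y w}"
  have "k \<le> card ?D"
    using T v x y \<open>x \<noteq> y\<close> by (simp add: k_metric_generator_def)
  also have "?D \<subseteq> (\<lambda>w. Inr (v, w)) ` ?E"
  proof
    fix z assume z: "z \<in> ?D"
    with TV have zV: "z \<in> pverts (corona G H)" by auto
    \<comment> \<open>a vertex outside the copy is equally far from both\<close>
    have "z \<in> range (\<lambda>w. Inr (v, w))"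
    proof (rule ccontr)
      assume "z \<notin> range (\<lambda>w. Inr (v, w))"
      with z show False
        using gdist_leave_copy[OF v x _ zV] gdist_leave_copy[OF v y _ zV] by simp
    qed
    then obtain w where w: "z = Inr (v, w)" by auto
    with zV have "w \<in> pverts (H v)" by simp
    with z w show "z \<in> (\<lambda>w. Inr (v, w)) ` ?E"
      using gdist_same_copy[OF v diam x] gdist_same_copy[OF v diam y] by auto
  qed
  then have "card ?D \<le> card ?E"
    using finite_subset[OF sub Hv.pair_finite_verts] by (intro surj_card_le) auto
  finally show "k \<le> card ?E" .
qed

lemma k_metric_generator_corona:
  assumes conn: "Digraph_Component.connected (with_proj G)" and two: "2 \<le> card (pverts G)"
    and two_H: "\<And>v. v \<in> pverts G \<Longrightarrow> 2 \<le> card (pverts (H v))"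
    and diam: "\<And>v. v \<in> pverts G \<Longrightarrow> diameter (H v) \<le> 2"
    and S: "\<And>v. v \<in> pverts G \<Longrightarrow> k_metric_generator k (H v) (S v)"
  shows "k_metric_generator k (corona G H) (Inr ` Sigma (pverts G) S)"
  unfolding k_metric_generator_def
proof (intro conjI ballI impI)
  let ?T = "Inr ` Sigma (pverts G) S :: ('a + 'a \<times> 'b) set"
  have SH: "S v \<subseteq> pverts (H v)" if "v \<in> pverts G" for v
    using S[OF that] by (simp add: k_metric_generator_def)
  then show TV: "?T \<subseteq> pverts (corona G H)"
    by (auto dest: subsetD[OF SH])
  fix p q assume p: "p \<in> pverts (corona G H)" and q: "q \<in> pverts (corona G H)" and "p \<noteq> q"
  let ?D = "{w \<in> ?T. gdist (corona G H) p w \<noteq> gdist (corona G H) q w}"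
  have "finite ?D"
    using finite_subset[OF TV C.pair_finite_verts] by simp
  \<comment> \<open>it suffices to distinguish the two vertices by \<open>k\<close> vertices of a single copy\<close>
  then have single_copy: "card A \<le> card ?D" if "(\<lambda>s. Inr (u, s)) ` A \<subseteq> ?D" for u A
    using card_inj_on_le[OF _ that] by (simp add: inj_on_def)
  show "k \<le> card ?D"
  proof (cases "\<exists>v x y. p = Inr (v, x) \<and> q = Inr (v, y)")
    case True
    then obtain v x y where pq: "p = Inr (v, x)" "q = Inr (v, y)" by blast
    with p q \<open>p \<noteq> q\<close> have v: "v \<in> pverts G" and xy: "x \<in> pverts (H v)" "y \<in> pverts (H v)" "x \<noteq> y"
      by auto
    let ?A = "{w \<in> S v. gdist (H v) x w \<noteq> gdist (H v) y w}"
    have "k \<le> card ?A"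
      using S[OF v] xy by (auto simp: k_metric_generator_def)
    also have "card ?A \<le> card ?D"
      using v xy SH[OF v] gdist_same_copy[OF v diam[OF v]]
      by (intro single_copy[of v]) (auto simp: pq subset_iff)
    finally show ?thesis .
  next
    case False
    then obtain u where u: "u \<in> pverts G" and sep: "\<And>s. s \<in> pverts (H u) \<Longrightarrow>
        gdist (corona G H) p (Inr (u, s)) \<noteq> gdist (corona G H) q (Inr (u, s))"
      using separating_copy[OF conn two p q \<open>p \<noteq> q\<close>] by blast
    have "k \<le> card (S u)"
      using k_metric_generator_le_card[OF S[OF u] two_H[OF u]] .
    also have "card (S u) \<le> card ?D"
      using u sep SH[OF u] by (intro single_copy[of u]) auto
    finally show ?thesis .
  qed
qed

lemma card_Inr_Sigma:
  assumes "\<And>v. v \<in> pverts G \<Longrightarrow> S v \<subseteq> pverts (H v)"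
  shows "card (Inr ` Sigma (pverts G) S) = (\<Sum>v\<in>pverts G. card (S v))"
proof -
  have "finite (S v)" if "v \<in> pverts G" for v
    using finite_subset[OF assms[OF that]] pair_graph_H[OF that]
    by (simp add: pair_graph_def pair_digraph_def pair_fin_digraph_def pair_fin_digraph_axioms_def)
  then show ?thesis
    by (simp add: card_image card_SigmaI G.pair_finite_verts)
qed

lemma k_metric_basis_corona:
  assumes conn: "Digraph_Component.connected (with_proj G)" and two: "2 \<le> card (pverts G)"
    and two_H: "\<And>v. v \<in> pverts G \<Longrightarrow> 2 \<le> card (pverts (H v))"
    and diam: "\<And>v. v \<in> pverts G \<Longrightarrow> diameter (H v) \<le> 2"
    and S: "\<And>v. v \<in> pverts G \<Longrightarrow> k_metric_basis k (H v) (S v)"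
  shows "k_metric_basis k (corona G H) (Inr ` Sigma (pverts G) S)"
  unfolding k_metric_basis_def
proof (intro conjI allI impI)
  have gen: "k_metric_generator k (H v) (S v)" if "v \<in> pverts G" for v
    using S[OF that] by (simp add: k_metric_basis_def)
  show "k_metric_generator k (corona G H) (Inr ` Sigma (pverts G) S)"
    using conn two two_H diam gen by (rule k_metric_generator_corona)
  fix T :: "('a + 'a \<times> 'b) set" assume T: "k_metric_generator k (corona G H) T"
  let ?F = "\<lambda>v. {x. Inr (v, x) \<in> T}"
  have fibre: "k_metric_generator k (H v) (?F v)" if "v \<in> pverts G" for v
    using k_metric_generator_fibre[OF T that diam[OF that]] .
  have "card (Inr ` Sigma (pverts G) S :: ('a + 'a \<times> 'b) set) = (\<Sum>v\<in>pverts G. card (S v))"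
    using gen by (intro card_Inr_Sigma) (simp add: k_metric_generator_def)
  also have "\<dots> \<le> (\<Sum>v\<in>pverts G. card (?F v))"
    using S fibre by (intro sum_mono) (simp add: k_metric_basis_def)
  also have "\<dots> = card (Inr ` Sigma (pverts G) ?F :: ('a + 'a \<times> 'b) set)"
    using fibre by (intro card_Inr_Sigma[symmetric]) (simp add: k_metric_generator_def)
  also have "\<dots> \<le> card T"
    using T finite_subset[OF _ C.pair_finite_verts]
    by (intro card_mono) (auto simp: k_metric_generator_def)
  finally show "card (Inr ` Sigma (pverts G) S :: ('a + 'a \<times> 'b) set) \<le> card T" .
qed

end

theorem theorem29:
  fixes G :: "'a pair_pre_digraph" and H :: "'a \<Rightarrow> 'b pair_pre_digraph"
    and \<kappa> :: "'a \<Rightarrow> nat" and k k' :: nat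
  assumes "pair_graph G" and "Digraph_Component.connected (with_proj G)"
    and "card (pverts G) \<ge> 2"
    and "\<And>v. v \<in> pverts G \<Longrightarrow> pair_graph (H v)"
    and "\<And>v. v \<in> pverts G \<Longrightarrow> card (pverts (H v)) \<ge> 2"
    and "\<And>v. v \<in> pverts G \<Longrightarrow> metric_dimensional (\<kappa> v) (H v)"
    and "\<And>v. v \<in> pverts G \<Longrightarrow> diameter (H v) \<le> 2"
    and "k' = Min (\<kappa> ` pverts G)"
    and "k \<in> {1..k'}"
  shows "k_metric_dim k (corona G H) = (\<Sum>v\<in>pverts G. k_metric_dim k (H v))"
proof -
  interpret corona_graph G H
    using assms(1,4) by (simp add: corona_graph_def corona_graph_axioms_def)
  \<comment> \<open>a \<open>\<kappa> v\<close>-metric basis is a \<open>k\<close>-metric generator, as \<open>k \<le> \<kappa> v\<close>\<close>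
  have "\<exists>B. k_metric_basis k (H v) B" if v: "v \<in> pverts G" for v
  proof -
    obtain B where "k_metric_generator (\<kappa> v) (H v) B"
      using assms(6)[OF v] by (auto simp: metric_dimensional_def k_metric_basis_def)
    moreover have "k' \<le> \<kappa> v"
      unfolding assms(8) using v G.pair_finite_verts by simp
    then have "k \<le> \<kappa> v"
      using assms(9) by simp
    ultimately show ?thesis
      by (rule k_metric_basis_exists[OF k_metric_generator_mono])
  qed
  then obtain S where S: "\<And>v. v \<in> pverts G \<Longrightarrow> k_metric_basis k (H v) (S v)"
    by metis
  have "k_metric_basis k (corona G H) (Inr ` Sigma (pverts G) S)"
    using assms(2,3,5,7) S by (rule k_metric_basis_corona)
  then have "k_metric_dim k (corona G H) = card (Inr ` Sigma (pverts G) S :: ('a + 'a \<times> 'b) set)"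
    by (rule k_metric_dim_eq)
  also have "\<dots> = (\<Sum>v\<in>pverts G. card (S v))"
    using S by (intro card_Inr_Sigma) (simp add: k_metric_basis_def k_metric_generator_def)
  also have "\<dots> = (\<Sum>v\<in>pverts G. k_metric_dim k (H v))"
    using k_metric_dim_eq[OF S] by simp
  finally show ?thesis .
qed

end
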